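(* There exists a topologically transitive subshift of finite type $X$ over the free group $\mathbb F_2=\langle a,b\rangle$ that admits more than one measure of maximal $f$-invariant; that is, there are at least two distinct shift-invariant Borel probability measures $\mu$ on $X$ such that $f_\mu(\mathbb F_2\curvearrowright X)\ge f_\nu(\mathbb F_2\curvearrowright X)$ for every shift-invariant Borel probability measure $\nu$ on $X$.
   Context: Let $K$ be a finite set and $\Gamma$ a countable group; $\Gamma$ acts on $K^\Gamma$ by the shift $(gx)(f)=x(g^{-1}f)$. Given a finite set $F\subset\Gamma$ and a collection $\Omega\subset K^F$, the subshift of finite type determined by $\Omega$ is the set $X$ of all $x\in K^\Gamma$ such that for every $g\in\Gamma$ the restriction of $gx$ to $F$ lies in $\Omega$. $f$-invariant: let $T$ denote a pmp action of $\mathbb F_2$ on $(X,\mu)$ and $S=\{a,b\}$. For a countable measurable partition $\mathcal P$ with finite Shannon entropy $H_\mu(\mathcal P)=-\sum_{P}\mu(P)\log\mu(P)$, set $F_\mu(T,\mathcal P)=H_\mu(\mathcal P)+\sum_{s\in S}\big(H_\mu(\mathcal P\vee T^s\mathcal P)-2H_\mu(\mathcal P)\big)$, and $f_\mu(T)=\inf_W F_\mu(T,\mathcal P^W)$, where $W$ ranges over nonempty finite subsets of $\mathbb F_2$, $\mathcal P^W=\bigvee_{w\in W}(T^w)^{-1}\mathcal P$, and $\mathcal P$ is any generating partition of finite Shannon entropy (generating: the smallest invariant sigma-algebra containing $\mathcal P$ is the Borel sigma-algebra modulo null sets). The value does not depend on the choice of $\mathcal P$. For a subshift one may take $\mathcal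 P$ to be the partition of $X$ according to the value $x(e)$. *)

theory Defs
  imports "HOL-Probability.Probability_Measure"
begin

section \<open>The free group of rank two\<close>

datatype generator = GenA | GenB

text \<open>
  The letter (\<open>s\<close>, True) stands for \<open>s\<close> and (\<open>s\<close>, False) for its inverse. Elements of the free
  group are the reduced words, multiplied by concatenation followed by cancellation. The only
  type class of possibly noncommutative groups in the library is \<^class>\<open>group_add\<close>, so the group
  is written additively: \<open>u + v\<close> is the product, \<open>- u\<close> the inverse, \<open>0\<close> the identity.
\<close>

type_synonym letter = "generator \<times> bool"

definition inv_letter :: "letter \<Rightarrow> letter" where
  "inv_letter l = (fst l, \<not> snd l)"

definition reduced_word :: "letter list \<Rightarrow> bool" where
  "reduced_word = successively (\<lambda>l l'. l' \<noteq> inv_letter l)"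

fun push :: "letter \<Rightarrow> letter list \<Rightarrow> letter list" where
  "push l [] = [l]"
| "push l (l' # w) = (if l' = inv_letter l then w else l # l' # w)"

lemma inv_letter_inv [simp]: "inv_letter (inv_letter l) = l"
  by (simp add: inv_letter_def)

lemma inv_letter_neq [simp]: "inv_letter l \<noteq> l" "l \<noteq> inv_letter l"
  by (simp_all add: inv_letter_def prod_eq_iff)

lemma reduced_Nil [simp]: "reduced_word []"
  by (simp add: reduced_word_def)

lemma reduced_Cons:
  "reduced_word (l # w) \<longleftrightarrow> reduced_word w \<and> (case w of [] \<Rightarrow> True | l' # _ \<Rightarrow> l' \<noteq> inv_letter l)"
  by (cases w) (auto simp: reduced_word_def)

lemma reduced_push: "reduced_word w \<Longrightarrow> reduced_word (push l w)"
  by (cases w) (simp_all add: reduced_Cons split: list.splits)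

lemma reduced_foldr_push: "reduced_word w \<Longrightarrow> reduced_word (foldr push u w)"
  by (induction u) (simp_all add: reduced_push)

lemma reduced_inverse: "reduced_word w \<Longrightarrow> reduced_word (rev (map inv_letter w))"
  unfolding reduced_word_def successively_rev successively_map
  by (erule successively_mono) auto

lemma push_cancel: "reduced_word w \<Longrightarrow> push l (push (inv_letter l) w) = w"
proof (cases w)
  case (Cons l' v)
  assume "reduced_word w"
  then show ?thesis using inv_letter_inv[of l] by (cases v) (auto simp only: Cons reduced_Cons push.simps list.case split: if_splits)
qed simp

lemma push_cancel': "reduced_word w \<Longrightarrow> push (inv_letter l) (push l w) = w"
  using push_cancel[of w "inv_letter l"] by simp

lemma foldr_push_push:
  "reduced_word w \<Longrightarrow> foldr push (push l v) w = push l (foldr push v w)"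
  by (cases v) (simp_all add: push_cancel reduced_foldr_push)

lemma foldr_push_assoc:
  "reduced_word w \<Longrightarrow> foldr push (foldr push u v) w = foldr push u (foldr push v w)"
  by (induction u) (simp_all add: foldr_push_push)

lemma push_reduced: "reduced_word (l # w) \<Longrightarrow> push l w = l # w"
  by (cases w) (simp_all add: reduced_Cons)

lemma foldr_push_Nil: "reduced_word w \<Longrightarrow> foldr push w [] = w"
proof (induction w)
  case (Cons l w)
  then have "reduced_word w" by (simp add: reduced_Cons)
  with Cons show ?case by (simp add: push_reduced)
qed simp

lemma foldr_push_inverse: "reduced_word w \<Longrightarrow> foldr push (rev (map inv_letter w)) w = []"
proof (induction w)
  case (Cons l w)
  then have "reduced_word w" by (simp add: reduced_Cons)
  with Cons show ?case by simp
qed simp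

typedef f2 = "{w. reduced_word w}"
  by (rule exI[of _ "[]"]) simp

setup_lifting type_definition_f2

instantiation f2 :: group_add
begin

lift_definition zero_f2 :: f2 is "[]" by simp

lift_definition plus_f2 :: "f2 \<Rightarrow> f2 \<Rightarrow> f2" is "\<lambda>u v. foldr push u v"
  by (rule reduced_foldr_push)

lift_definition uminus_f2 :: "f2 \<Rightarrow> f2" is "\<lambda>w. rev (map inv_letter w)"
  by (rule reduced_inverse)

definition minus_f2 :: "f2 \<Rightarrow> f2 \<Rightarrow> f2" where
  "minus_f2 u v = u + - v"

instance
proof
  fix u v w :: f2
  show "u + v + w = u + (v + w)" by transfer (rule foldr_push_assoc)
  show "0 + u = u" by transfer simp
  show "u + 0 = u" by transfer (rule foldr_push_Nil)
  show "- u + u = 0" by transfer (rule foldr_push_inverse)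
  show "u + - v = u - v" by (simp add: minus_f2_def)
qed

end

lift_definition gen_f2 :: "generator \<Rightarrow> f2" is "\<lambda>s. [(s, True)]"
  by (simp add: reduced_word_def)

instance generator :: countable
  by countable_datatype

instance f2 :: countable
  by (rule countable_classI[of "\<lambda>x. to_nat (Rep_f2 x)"]) (simp add: Rep_f2_inject)

text \<open>The universal property: the group constructed above is free on its two generators.\<close>

definition letter_value :: "(generator \<Rightarrow> 'h::group_add) \<Rightarrow> letter \<Rightarrow> 'h" where
  "letter_value v l = (if snd l then v (fst l) else - v (fst l))"

lemma sum_list_push:
  "sum_list (map (letter_value v) (push l w)) = letter_value v l + sum_list (map (letter_value v) w)"
  by (cases w) (auto simp: letter_value_def inv_letter_def add.assoc[symmetric])

lemma f2_universal:
  fixes v :: "generator \<Rightarrow> 'h::group_add"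
  shows "\<exists>!h :: f2 \<Rightarrow> 'h. (\<forall>x y. h (x + y) = h x + h y) \<and> (\<forall>s. h (gen_f2 s) = v s)"
proof (rule ex_ex1I)
  define h where "h x = sum_list (map (letter_value v) (Rep_f2 x))" for x
  have "sum_list (map (letter_value v) (foldr push u w)) =
      sum_list (map (letter_value v) u) + sum_list (map (letter_value v) w)" for u w
    by (induction u) (simp_all add: sum_list_push add.assoc)
  then have "\<forall>x y. h (x + y) = h x + h y"
    by (simp add: h_def plus_f2.rep_eq)
  moreover have "\<forall>s. h (gen_f2 s) = v s"
    by (simp add: h_def gen_f2.rep_eq letter_value_def)
  ultimately show "\<exists>h. (\<forall>x y. h (x + y) = h x + h y) \<and> (\<forall>s. h (gen_f2 s) = v s)"
    by blast
next
  have unique: "h (Abs_f2 w) = sum_list (map (letter_value v) w)"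
    if add: "\<forall>x y. h (x + y) = h x + h y" and gen: "\<forall>s. h (gen_f2 s) = v s" and "reduced_word w"
    for h :: "f2 \<Rightarrow> 'h" and w
    using \<open>reduced_word w\<close>
  proof (induction w)
    case Nil
    have "h 0 + h 0 = h 0 + 0" using add[rule_format, of 0 0] by simp
    then have "h 0 = 0" by (rule add_left_imp_eq)
    then show ?case by (simp add: zero_f2_def)
  next
    case (Cons l w)
    have "h 0 + h 0 = h 0 + 0" using add[rule_format, of 0 0] by simp
    then have "h 0 = 0" by (rule add_left_imp_eq)
    then have "h x + h (- x) = 0" for x using add[rule_format, of x "- x"] by simp
    then have neg: "h (- x) = - h x" for x by (rule minus_unique[symmetric])
    obtain s e where l: "l = (s, e)" by force
    have red: "reduced_word w" using Cons.prems by (simp add: reduced_Cons)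
    have "Abs_f2 [l] = (if e then gen_f2 s else - gen_f2 s)"
      by (simp add: l gen_f2_def uminus_f2_def Abs_f2_inverse reduced_word_def inv_letter_def)
    then have hl: "h (Abs_f2 [l]) = letter_value v l"
      using gen neg by (simp add: l letter_value_def)
    have "Abs_f2 (l # w) = Abs_f2 [l] + Abs_f2 w"
      using red push_reduced[OF Cons.prems]
      by (simp add: plus_f2_def Abs_f2_inverse reduced_Cons)
    then show ?case using add hl Cons.IH[OF red] by simp
  qed
  fix h k :: "f2 \<Rightarrow> 'h"
  assume h: "(\<forall>x y. h (x + y) = h x + h y) \<and> (\<forall>s. h (gen_f2 s) = v s)"
    and k: "(\<forall>x y. k (x + y) = k x + k y) \<and> (\<forall>s. k (gen_f2 s) = v s)"
  show "h = k"
  proof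
    fix x
    obtain w where "x = Abs_f2 w" "reduced_word w" by (cases x) auto
    then show "h x = k x" using unique[of h w] unique[of k w] h k by simp
  qed
qed


section \<open>Subshifts\<close>

definition shift_action :: "'g::group_add \<Rightarrow> ('g \<Rightarrow> 'k) \<Rightarrow> 'g \<Rightarrow> 'k" where
  "shift_action g x = (\<lambda>f. x (- g + f))"

text \<open>\<open>F \<rightarrow>\<^sub>E K\<close> is the set of functions from \<open>F\<close> to \<open>K\<close>, and the alphabet is a finite set \<open>K\<close>.\<close>

definition subshift_of_finite_type :: "'k set \<Rightarrow> ('g::group_add \<Rightarrow> 'k) set \<Rightarrow> bool" where
  "subshift_of_finite_type K X \<longleftrightarrow> finite K \<and>
     (\<exists>F \<Omega>. finite F \<and> \<Omega> \<subseteq> (F \<rightarrow>\<^sub>E K) \<and>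
        X = {x. range x \<subseteq> K \<and> (\<forall>g. restrict (shift_action g x) F \<in> \<Omega>)})"

text \<open>
  The function space carries the product topology; for a discrete alphabet type this is the
  product of discrete spaces.
\<close>

definition topologically_transitive ::
    "('g::group_add \<Rightarrow> 'k::discrete_topology) set \<Rightarrow> bool" where
  "topologically_transitive X \<longleftrightarrow>
     (\<forall>U V. openin (top_of_set X) U \<and> openin (top_of_set X) V \<and> U \<noteq> {} \<and> V \<noteq> {} \<longrightarrow>
        (\<exists>g. shift_action g ` U \<inter> V \<noteq> {}))"

definition pmp_action :: "'x measure \<Rightarrow> ('g::group_add \<Rightarrow> 'x \<Rightarrow> 'x) \<Rightarrow> bool" where
  "pmp_action M T \<longleftrightarrow> prob_space M \<and>
     (\<forall>g. T g \<in> measurable M M \<and> distr M M (T g) = M) \<and>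
     (\<forall>x\<in>space M. T 0 x = x) \<and>
     (\<forall>g h. \<forall>x\<in>space M. T (g + h) x = T g (T h x))"

definition invariant_measures ::
    "('g::group_add \<Rightarrow> 'k::discrete_topology) set \<Rightarrow> ('g \<Rightarrow> 'k) measure set" where
  "invariant_measures X = {\<mu>. sets \<mu> = sets (restrict_space borel X) \<and> pmp_action \<mu> shift_action}"


section \<open>The f-invariant\<close>

text \<open>
  A partition is a set of nonempty cells. Entropies are taken with respect to the natural
  logarithm, and \<open>0 * ln 0 = 0\<close>.
\<close>

definition countable_partition :: "'x measure \<Rightarrow> 'x set set \<Rightarrow> bool" where
  "countable_partition M P \<longleftrightarrow> countable P \<and> P \<subseteq> sets M \<and> partition_on (space M) P"

definition finite_entropy :: "'x measure \<Rightarrow> 'x set set \<Rightarrow> bool" where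
  "finite_entropy M P \<longleftrightarrow> (\<lambda>A. measure M A * ln (measure M A)) summable_on P"

definition shannon_entropy :: "'x measure \<Rightarrow> 'x set set \<Rightarrow> real" where
  "shannon_entropy M P = - (\<Sum>\<^sub>\<infinity>A\<in>P. measure M A * ln (measure M A))"

definition partition_join :: "'x set set \<Rightarrow> 'x set set \<Rightarrow> 'x set set" where
  "partition_join P Q = {A \<inter> B | A B. A \<in> P \<and> B \<in> Q} - {{}}"

text \<open>
  The cells of the join over \<open>w \<in> W\<close> of the preimages of \<open>P\<close> under \<open>T w\<close> are indexed by the
  choices \<open>\<phi>\<close> of one cell of \<open>P\<close> for every \<open>w\<close>.
\<close>

definition refined_partition ::
    "'x measure \<Rightarrow> ('g \<Rightarrow> 'x \<Rightarrow> 'x) \<Rightarrow> 'x set set \<Rightarrow> 'g set \<Rightarrow> 'x set set" where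
  "refined_partition M T P W =
     {{x \<in> space M. \<forall>w\<in>W. T w x \<in> \<phi> w} | \<phi>. \<phi> \<in> W \<rightarrow> P} - {{}}"

definition F_value :: "'x measure \<Rightarrow> (f2 \<Rightarrow> 'x \<Rightarrow> 'x) \<Rightarrow> 'x set set \<Rightarrow> real" where
  "F_value M T P = shannon_entropy M P +
     (\<Sum>s\<in>{gen_f2 GenA, gen_f2 GenB}.
        shannon_entropy M (partition_join P ((`) (T s) ` P)) - 2 * shannon_entropy M P)"

definition generating_partition ::
    "'x measure \<Rightarrow> ('g \<Rightarrow> 'x \<Rightarrow> 'x) \<Rightarrow> 'x set set \<Rightarrow> bool" where
  "generating_partition M T P \<longleftrightarrow> countable_partition M P \<and>
     (\<forall>B\<in>sets M. \<exists>C\<in>sigma_sets (space M) {T g -` A \<inter> space M | g A. A \<in> P}.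
        measure M ((B - C) \<union> (C - B)) = 0)"

text \<open>
  For a pmp action \<open>T\<close> and a generating partition \<open>P\<close> of finite entropy, this is the
  f-invariant of the action, whose value does not depend on \<open>P\<close>. It can be \<open>-\<infinity>\<close>.
\<close>

definition f_invariant :: "'x measure \<Rightarrow> (f2 \<Rightarrow> 'x \<Rightarrow> 'x) \<Rightarrow> 'x set set \<Rightarrow> ereal" where
  "f_invariant M T P =
     (INF W\<in>{W. finite W \<and> W \<noteq> {}}. ereal (F_value M T (refined_partition M T P W)))"

definition coordinate_partition :: "('g::group_add \<Rightarrow> 'k) set \<Rightarrow> ('g \<Rightarrow> 'k) set set" where
  "coordinate_partition X = {{x \<in> X. x 0 = k} | k. k \<in> (\<lambda>x. x 0) ` X}"

definition shift_f_invariant ::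
    "(f2 \<Rightarrow> 'k::discrete_topology) set \<Rightarrow> (f2 \<Rightarrow> 'k) measure \<Rightarrow> ereal" where
  "shift_f_invariant X \<mu> = f_invariant \<mu> shift_action (coordinate_partition X)"

text \<open>The partition used in \<^const>\<open>shift_f_invariant\<close> is admissible in \<^const>\<open>f_invariant\<close>.\<close>

lemma coordinate_partition_admissible:
  fixes X :: "('g::{group_add,countable} \<Rightarrow> 'k::{discrete_topology,second_countable_topology,countable}) set"
  assumes X: "subshift_of_finite_type K X" and \<mu>: "\<mu> \<in> invariant_measures X"
  shows "generating_partition \<mu> shift_action (coordinate_partition X)"
    and "finite_entropy \<mu> (coordinate_partition X)"
proof -
  let ?P = "coordinate_partition X"
  let ?G = "{shift_action g -` A \<inter> space \<mu> | g A. A \<in> ?P}"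
  have sets: "sets \<mu> = sets (restrict_space borel X)"
    using \<mu> by (simp add: invariant_measures_def)
  have space: "space \<mu> = X"
    by (simp add: sets_eq_imp_space_eq[OF sets] space_restrict_space)
  have "(\<lambda>x. x 0) ` X \<subseteq> K" "finite K"
    using X by (auto simp: subshift_of_finite_type_def)
  then have fin: "finite ?P"
    by (auto simp: coordinate_partition_def Setcompr_eq_image intro: finite_subset)
  then show "finite_entropy \<mu> ?P" by (simp add: finite_entropy_def)
  have coord: "(\<lambda>x. x g) -` {k} \<in> sets (borel :: ('g \<Rightarrow> 'k) measure)" for g k
    by (intro borel_open open_vimage continuous_on_product_coordinates) (rule Topological_Spaces.open_discrete)
  have "{x \<in> X. x 0 = k} \<in> sets \<mu>" for k
    using coord[of 0 k] by (auto simp: sets sets_restrict_space image_iff vimage_def)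
  moreover have "partition_on X ?P"
    by (auto simp: coordinate_partition_def partition_on_def disjoint_def)
  ultimately have "countable_partition \<mu> ?P"
    using fin by (auto simp: countable_partition_def space countable_finite coordinate_partition_def)
  moreover have "sets \<mu> \<subseteq> sigma_sets X ?G"
  proof
    fix B assume "B \<in> sets \<mu>"
    then obtain C where C: "C \<in> sets (borel :: ('g \<Rightarrow> 'k) measure)" "B = C \<inter> X"
      by (auto simp: sets sets_restrict_space)
    have shift_inv: "shift_action g x \<in> X" if "x \<in> X" for g x
      using \<mu> that space unfolding invariant_measures_def pmp_action_def
      by (auto dest!: measurable_space)
    have gen: "(\<lambda>x. x g) -` {k} \<inter> X \<in> sigma_sets X ?G" for g k
    proof (cases "\<exists>y\<in>X. y g = k")
      case True
      then obtain y where y: "y \<in> X" "y g = k" by blast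
      have "shift_action (- g) y \<in> X" using shift_inv y(1) by blast
      moreover have "shift_action (- g) y 0 = k" using y(2) by (simp add: shift_action_def)
      ultimately have "k \<in> (\<lambda>x. x 0) ` X" by blast
      then have "{x \<in> X. x 0 = k} \<in> ?P" by (auto simp: coordinate_partition_def)
      moreover have "(\<lambda>x. x g) -` {k} \<inter> X = shift_action (- g) -` {x \<in> X. x 0 = k} \<inter> space \<mu>"
        using shift_inv[of _ "- g"] by (auto simp: space shift_action_def)
      ultimately show ?thesis by blast
    next
      case False
      then have "(\<lambda>x. x g) -` {k} \<inter> X = {}" by auto
      then show ?thesis by (simp only: sigma_sets.Empty)
    qed
    interpret S: sigma_algebra X "sigma_sets X ?G"
      by (rule sigma_algebra_sigma_sets) (auto simp: space)
    have "C \<in> sets (PiM UNIV (\<lambda>_::'g. borel :: 'k measure))"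
      using C(1) by (simp add: sets_PiM_equal_borel)
    then have "C \<in> sigma_sets UNIV {{f. f i \<in> A} |i A. A \<in> sets (borel :: 'k measure)}"
      by (simp add: sets_PiM_single PiE_def)
    then have "C \<inter> X \<in> sigma_sets X ?G"
    proof (induction rule: sigma_sets.induct)
      case (Basic D)
      then obtain i A where D: "D = {f. f i \<in> A}" by blast
      have "(\<Union>k\<in>A. (\<lambda>x. x i) -` {k} \<inter> X) \<in> sigma_sets X ?G"
        using gen by (intro S.countable_UN'') auto
      moreover have "(\<Union>k\<in>A. (\<lambda>x. x i) -` {k} \<inter> X) = D \<inter> X" using D by auto
      ultimately show ?case by simp
    next
      case (Compl D)
      have "X - D \<inter> X \<in> sigma_sets X ?G" by (rule sigma_sets.Compl) (rule Compl.IH)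
      moreover have "X - D \<inter> X = (UNIV - D) \<inter> X" by auto
      ultimately show ?case by simp
    next
      case (Union D)
      have "(\<Union>i. D i \<inter> X) \<in> sigma_sets X ?G" by (rule sigma_sets.Union) (rule Union.IH)
      moreover have "(\<Union>i. D i \<inter> X) = (\<Union>i. D i) \<inter> X" by auto
      ultimately show ?case by simp
    qed (auto intro: sigma_sets.Empty)
    then show "B \<in> sigma_sets X ?G" using C by simp
  qed
  ultimately show "generating_partition \<mu> shift_action ?P"
    unfolding generating_partition_def space by force
qed

definition max_f_measures ::
    "(f2 \<Rightarrow> 'k::discrete_topology) set \<Rightarrow> (f2 \<Rightarrow> 'k) measure set" where
  "max_f_measures X = {\<mu> \<in> invariant_measures X.
     \<forall>\<nu>\<in>invariant_measures X. shift_f_invariant X \<mu> \<ge> shift_f_invariant X \<nu>}"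

end

theory Submission
  imports Defs "HOL-Probability.Giry_Monad"
begin

text \<open>
  Let \<open>X\<close> consist of the \<open>0\<close>-\<open>1\<close> labellings of the free group that are nondecreasing along every
  edge \<open>h \<rightarrow> h + s\<close> of the right Cayley graph, where \<open>s\<close> is a generator. This is the analogue of
  the integer subshift consisting of \<open>0\<^sup>\<infinity>\<close>, \<open>1\<^sup>\<infinity>\<close> and the translates of \<open>0\<^sup>\<infinity>1\<^sup>\<infinity>\<close>.

  An invariant measure gives the events \<open>x 0 = 1\<close> and \<open>x s = 1\<close> the same probability, and the first
  implies the second. Hence almost surely \<open>x 0 = x s\<close>: the only invariant measures are mixtures
  of the point masses at the two constant labellings. Therefore joining the coordinate partition
  \<open>P\<close> with its translate by \<open>s\<close> does not change its entropy \<open>H\<close>, so that the quantity whose infimum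
  is the f-invariant has, for \<open>W = {0}\<close>, the value \<open>H + 2 * (H - 2 * H) = - H \<le> 0\<close>
  (\<open>shift_f_invariant_nonpos\<close>). For a point mass all entropies vanish, and the f-invariant is \<open>0\<close>
  (\<open>point_mass_f_invariant\<close>). So both point masses have maximal f-invariant.

  Although it carries so few invariant measures, \<open>X\<close> is topologically transitive
  (\<open>monotone_labellings_transitive\<close>). It is closed under pointwise minima and maxima, and it
  contains the indicators of the half-spaces \<open>N \<le> \<phi> h\<close> for homomorphisms \<open>\<phi>\<close> to the integers that
  are nonnegative on the generators. Two such homomorphisms, the exponent sums of \<open>a\<close> and of \<open>b\<close>,
  suffice to glue a finite pattern of one labelling to a translated pattern of another.
\<close>


section \<open>Monotone labellings\<close>

definition monotone_labellings :: "(f2 \<Rightarrow> nat) set" where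
  "monotone_labellings = {x. (\<forall>h. x h \<le> 1) \<and> (\<forall>h s. x h \<le> x (h + gen_f2 s))}"

text \<open>
  Restricted to the window \<open>{0, a, b}\<close>, the translate of \<open>x\<close> by \<open>g\<close> shows the values of \<open>x\<close> at
  \<open>- g\<close>, \<open>- g + a\<close>, \<open>- g + b\<close>, so this window sees exactly the edges that leave \<open>- g\<close>.
\<close>

lemma monotone_labellings_sft: "subshift_of_finite_type {0, 1} monotone_labellings"
proof -
  let ?F = "insert 0 (range gen_f2)"
  let ?\<Omega> = "{\<omega> \<in> ?F \<rightarrow>\<^sub>E {0, 1 :: nat}. \<forall>s. \<omega> 0 \<le> \<omega> (gen_f2 s)}"
  have "(UNIV :: generator set) = {GenA, GenB}" using generator.exhaust by blast
  then have "finite (UNIV :: generator set)" by (metis finite.emptyI finite_insert)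
  then have fin: "finite ?F" by blast
  have range: "range x \<subseteq> {0, 1} \<longleftrightarrow> (\<forall>h. x h \<le> 1)" for x :: "f2 \<Rightarrow> nat"
    unfolding image_subset_iff by (auto simp: le_Suc_eq)
  have window: "restrict (shift_action g x) ?F \<in> ?\<Omega> \<longleftrightarrow> (\<forall>s. x (- g) \<le> x (- g + gen_f2 s))"
    if x: "\<forall>h. x h \<le> 1" for x g
  proof -
    have "shift_action g x i \<in> {0, 1}" for i
      using spec[OF x, of "- g + i"] by (auto simp: shift_action_def)
    then have "restrict (shift_action g x) ?F \<in> ?F \<rightarrow>\<^sub>E {0, 1}"
      unfolding restrict_PiE_iff by (intro ballI)
    then show ?thesis by (simp add: shift_action_def)
  qed
  have all_neg: "(\<forall>g :: f2. \<forall>s. R (- g) s) \<longleftrightarrow> (\<forall>h s. R h s)" for R :: "f2 \<Rightarrow> generator \<Rightarrow> bool"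
    by (metis minus_minus)
  have "(\<forall>g. restrict (shift_action g x) ?F \<in> ?\<Omega>) \<longleftrightarrow> (\<forall>h s. x h \<le> x (h + gen_f2 s))"
    if "\<forall>h. x h \<le> 1" for x
    unfolding window[OF that] by (rule all_neg)
  then have X: "monotone_labellings =
      {x. range x \<subseteq> {0, 1} \<and> (\<forall>g. restrict (shift_action g x) ?F \<in> ?\<Omega>)}"
    unfolding monotone_labellings_def range by (intro Collect_cong conj_cong refl) simp
  show ?thesis
    unfolding subshift_of_finite_type_def
  proof (intro conjI exI)
    show "finite {0, 1 :: nat}" by simp
    show "finite ?F" by (rule fin)
    show "?\<Omega> \<subseteq> ?F \<rightarrow>\<^sub>E {0, 1}" by (rule Collect_subset)
    show "monotone_labellings =
        {x. range x \<subseteq> {0, 1} \<and> (\<forall>g. restrict (shift_action g x) ?F \<in> ?\<Omega>)}" by (rule X)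
  qed
qed

lemma const_monotone: "c \<in> {0, 1} \<Longrightarrow> (\<lambda>_. c) \<in> monotone_labellings"
  by (auto simp: monotone_labellings_def)

lemma monotone_labellings_values: "x \<in> monotone_labellings \<Longrightarrow> x h = 0 \<or> x h = 1"
proof -
  assume "x \<in> monotone_labellings"
  then have "x h \<le> 1" by (simp add: monotone_labellings_def)
  then show ?thesis by linarith
qed

lemma shift_monotone: "x \<in> monotone_labellings \<Longrightarrow> shift_action g x \<in> monotone_labellings"
  by (simp add: monotone_labellings_def shift_action_def flip: add.assoc)

lemma min_monotone:
  assumes "x \<in> monotone_labellings" and "y \<in> monotone_labellings"
  shows "(\<lambda>h. min (x h) (y h)) \<in> monotone_labellings"
proof -
  have "min (x h) (y h) \<le> min (x (h + gen_f2 s)) (y (h + gen_f2 s))" for h s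
    using assms by (intro min.mono) (simp_all add: monotone_labellings_def)
  moreover have "min (x h) (y h) \<le> 1" for h
    using monotone_labellings_values[OF assms(1), of h] monotone_labellings_values[OF assms(2), of h]
    by auto
  ultimately show ?thesis unfolding monotone_labellings_def by blast
qed

lemma max_monotone:
  assumes "x \<in> monotone_labellings" and "y \<in> monotone_labellings"
  shows "(\<lambda>h. max (x h) (y h)) \<in> monotone_labellings"
proof -
  have "max (x h) (y h) \<le> max (x (h + gen_f2 s)) (y (h + gen_f2 s))" for h s
    using assms by (intro max.mono) (simp_all add: monotone_labellings_def)
  moreover have "max (x h) (y h) \<le> 1" for h
    using monotone_labellings_values[OF assms(1), of h] monotone_labellings_values[OF assms(2), of h]
    by auto
  ultimately show ?thesis unfolding monotone_labellings_def by blast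
qed

lemma halfspace_monotone:
  fixes \<phi> :: "f2 \<Rightarrow> int"
  assumes "\<And>u v. \<phi> (u + v) = \<phi> u + \<phi> v" and "\<And>s. 0 \<le> \<phi> (gen_f2 s)"
  shows "(\<lambda>h. of_bool (N \<le> \<phi> h)) \<in> monotone_labellings"
proof -
  have "N \<le> \<phi> (h + gen_f2 s)" if "N \<le> \<phi> h" for h s
    using that assms(1)[of h "gen_f2 s"] assms(2)[of s] by linarith
  then show ?thesis by (auto simp: monotone_labellings_def)
qed


section \<open>Topological transitivity\<close>

lemma openin_determined_by_window:
  fixes X :: "('g \<Rightarrow> 'k::discrete_topology) set"
  assumes "openin (top_of_set X) U" and "x \<in> U"
  obtains J where "finite J" and "\<And>z. z \<in> X \<Longrightarrow> (\<And>h. h \<in> J \<Longrightarrow> z h = x h) \<Longrightarrow> z \<in> U"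
proof -
  obtain T where T: "open T" "U = X \<inter> T"
    using assms(1) by (auto simp: openin_open)
  then have "openin (product_topology (\<lambda>_. euclidean) UNIV) T" "x \<in> T"
    using assms(2) by (auto simp: open_fun_def)
  from product_topology_open_contains_basis[OF this] obtain B
    where B: "x \<in> (\<Pi>\<^sub>E i\<in>UNIV. B i)" "finite {i. B i \<noteq> topspace (euclidean :: 'k topology)}"
    "(\<Pi>\<^sub>E i\<in>UNIV. B i) \<subseteq> T"
    by (elim exE conjE) (rule that)
  show thesis
  proof
    show "finite {i. B i \<noteq> UNIV}" using B(2) by simp
  next
    fix z assume z: "z \<in> X" "\<And>h. h \<in> {i. B i \<noteq> UNIV} \<Longrightarrow> z h = x h"
    have "z h \<in> B h" for h
      using z(2)[of h] B(1) by (cases "B h = UNIV") (auto simp: PiE_iff)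
    then have "z \<in> T" using B(3) by (auto simp: PiE_iff)
    then show "z \<in> U" using T z by simp
  qed
qed

text \<open>
  Let the open sets contain \<open>x\<close> and \<open>y\<close> together with everything that agrees with them on the finite
  sets \<open>J\<close> and \<open>L\<close>, and let \<open>\<alpha>\<close> and \<open>\<beta>\<close> be the exponent sums of the two generators. Raising \<open>x\<close> to
  \<open>1\<close> where \<open>\<alpha>\<close> is large does not change it on \<open>J\<close>. Raising the translate of \<open>y\<close> by \<open>k\<close> to \<open>1\<close> where
  \<open>\<beta>\<close> is not too small does not change it on \<open>k + L\<close>, if \<open>\<beta> k\<close> is very negative. If also \<open>\<alpha> k\<close> is
  large, each of the two modified labellings is \<open>1\<close> where the other one has to be seen, and their
  minimum shows both patterns. The opposite signs of \<open>\<alpha> k\<close> and \<open>\<beta> k\<close> make the patterns incomparable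
  in the order, so neither constrains the other.
\<close>

lemma monotone_labellings_transitive: "topologically_transitive monotone_labellings"
  unfolding topologically_transitive_def
proof (intro allI impI, elim conjE)
  fix U V :: "(f2 \<Rightarrow> nat) set"
  assume U: "openin (top_of_set monotone_labellings) U" and V: "openin (top_of_set monotone_labellings) V"
    and "U \<noteq> {}" "V \<noteq> {}"
  then obtain x y where x: "x \<in> U" and y: "y \<in> V" by blast
  with U V have xX: "x \<in> monotone_labellings" and yX: "y \<in> monotone_labellings"
    by (auto dest: openin_imp_subset)
  obtain J where J: "finite J" "\<And>z. z \<in> monotone_labellings \<Longrightarrow> (\<And>h. h \<in> J \<Longrightarrow> z h = x h) \<Longrightarrow> z \<in> U"
    using openin_determined_by_window[OF U x] by blast
  obtain L where L: "finite L" "\<And>z. z \<in> monotone_labellings \<Longrightarrow> (\<And>h. h \<in> L \<Longrightarrow> z h = y h) \<Longrightarrow> z \<in> V"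
    using openin_determined_by_window[OF V y] by blast
  obtain \<alpha> :: "f2 \<Rightarrow> int" where \<alpha>: "\<And>u v. \<alpha> (u + v) = \<alpha> u + \<alpha> v"
      "\<And>s. \<alpha> (gen_f2 s) = of_bool (s = GenA)"
    using f2_universal[of "\<lambda>s. of_bool (s = GenA) :: int"] by blast
  obtain \<beta> :: "f2 \<Rightarrow> int" where \<beta>: "\<And>u v. \<beta> (u + v) = \<beta> u + \<beta> v"
      "\<And>s. \<beta> (gen_f2 s) = of_bool (s = GenB)"
    using f2_universal[of "\<lambda>s. of_bool (s = GenB) :: int"] by blast
  have zero: "\<alpha> 0 = 0" "\<beta> 0 = 0" using \<alpha>(1)[of 0 0] \<beta>(1)[of 0 0] by simp_all
  have neg: "\<alpha> (- u) = - \<alpha> u" "\<beta> (- u) = - \<beta> u" for u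
    using \<alpha>(1)[of u "- u"] \<beta>(1)[of u "- u"] zero by simp_all
  have "\<exists>n::nat. \<forall>h\<in>J \<union> L. \<bar>\<alpha> h\<bar> < int n \<and> \<bar>\<beta> h\<bar> < int n"
  proof (intro exI ballI)
    fix h assume h: "h \<in> J \<union> L"
    let ?f = "\<lambda>h. nat (\<bar>\<alpha> h\<bar> + \<bar>\<beta> h\<bar>)"
    have "?f h \<le> (\<Sum>h\<in>J \<union> L. ?f h)"
      using J(1) L(1) h by (intro member_le_sum) auto
    then show "\<bar>\<alpha> h\<bar> < int (Suc (\<Sum>h\<in>J \<union> L. ?f h)) \<and> \<bar>\<beta> h\<bar> < int (Suc (\<Sum>h\<in>J \<union> L. ?f h))"
      by linarith
  qed
  then obtain n :: nat where n: "\<And>h. h \<in> J \<union> L \<Longrightarrow> \<bar>\<alpha> h\<bar> < int n" "\<And>h. h \<in> J \<union> L \<Longrightarrow> \<bar>\<beta> h\<bar> < int n"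
    by blast
  \<comment> \<open>The witness is the sum of \<open>m\<close> copies of \<open>a - b\<close>.\<close>
  have "\<exists>k. \<alpha> k = int m \<and> \<beta> k = - int m" for m
  proof (induction m)
    case (Suc m)
    then obtain k where "\<alpha> k = int m \<and> \<beta> k = - int m" by blast
    then show ?case
      by (intro exI[of _ "k + gen_f2 GenA + - gen_f2 GenB"]) (simp del: add_uminus_conv_diff add: \<alpha> \<beta> neg)
  qed (use zero in auto)
  then obtain k where k: "\<alpha> k = int (2 * n)" "\<beta> k = - int (2 * n)" by blast
  \<comment> \<open>\<open>J\<close> and \<open>L\<close> lie in \<open>\<bar>\<alpha>\<bar>, \<bar>\<beta>\<bar> < n\<close>, hence \<open>k + L\<close> lies in \<open>\<alpha> > n\<close>, \<open>\<beta> < - n\<close>: the thresholds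
    \<open>n\<close> for \<open>\<alpha>\<close> and \<open>- n\<close> for \<open>\<beta>\<close> separate the two sets.\<close>
  define z where "z = (\<lambda>h. min (max (x h) (of_bool (int n \<le> \<alpha> h)))
                               (max (shift_action k y h) (of_bool (- int n \<le> \<beta> h))))"
  have zX: "z \<in> monotone_labellings"
    unfolding z_def
    by (intro min_monotone max_monotone shift_monotone halfspace_monotone xX yX) (simp_all add: \<alpha> \<beta>)
  have bounds: "x h \<le> 1" "y h \<le> 1" for h
    using monotone_labellings_values[OF xX, of h] monotone_labellings_values[OF yX, of h] by auto
  have "z h = x h" if "h \<in> J" for h
  proof -
    have "\<not> int n \<le> \<alpha> h" "- int n \<le> \<beta> h" using n[of h] that by auto
    moreover have "shift_action k y h \<le> 1" by (simp only: shift_action_def bounds)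
    ultimately show ?thesis using bounds(1)[of h] by (simp add: z_def)
  qed
  then have "z \<in> U" using J(2) zX by blast
  moreover have "shift_action (- k) z h = y h" if "h \<in> L" for h
  proof -
    have "int n \<le> \<alpha> (k + h)" "\<not> - int n \<le> \<beta> (k + h)" using n[of h] that by (auto simp: \<alpha> \<beta> k)
    moreover have "shift_action k y (k + h) = y h"
      by (simp add: shift_action_def add.assoc[symmetric])
    moreover have "shift_action (- k) z h = z (k + h)" by (simp add: shift_action_def)
    ultimately show ?thesis using bounds(1)[of "k + h"] bounds(2)[of h] by (simp add: z_def)
  qed
  then have "shift_action (- k) z \<in> V" using L(2) shift_monotone[OF zX] by blast
  ultimately show "\<exists>g. shift_action g ` U \<inter> V \<noteq> {}" by blast
qed


section \<open>Point masses have f-invariant zero\<close>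

lemma shannon_entropy_zero_one_law:
  assumes "\<And>A. measure M A \<in> {0, 1}"
  shows "shannon_entropy M P = 0"
proof -
  have "measure M A * ln (measure M A) = 0" for A using assms[of A] by auto
  then have "(\<Sum>\<^sub>\<infinity>A\<in>P. measure M A * ln (measure M A)) = 0" by (intro infsum_0)
  then show ?thesis by (simp add: shannon_entropy_def)
qed

lemma f_invariant_zero_one_law:
  assumes "\<And>A. measure M A \<in> {0, 1}"
  shows "f_invariant M T P = 0"
proof -
  have "{W :: f2 set. finite W \<and> W \<noteq> {}} \<noteq> {}" by (auto intro: exI[of _ "{0}"])
  then show ?thesis
    by (simp add: f_invariant_def F_value_def shannon_entropy_zero_one_law[OF assms] zero_ereal_def[symmetric])
qed

lemma shift_action_zero: "shift_action 0 x = x"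
  by (simp add: shift_action_def)

lemma shift_action_add: "shift_action (g + h) x = shift_action g (shift_action h x)"
  by (simp only: shift_action_def minus_add add.assoc)

lemma shift_action_measurable:
  fixes X :: "('g::{group_add,countable} \<Rightarrow> 'k::{discrete_topology,second_countable_topology}) set"
  assumes "\<And>x. x \<in> X \<Longrightarrow> shift_action g x \<in> X"
  shows "shift_action g \<in> measurable (restrict_space borel X) (restrict_space borel X)"
proof -
  have "continuous_on UNIV (shift_action g :: ('g \<Rightarrow> 'k) \<Rightarrow> _)"
    unfolding shift_action_def
    by (intro continuous_on_coordinatewise_then_product continuous_on_product_coordinates)
  then have "(shift_action g :: ('g \<Rightarrow> 'k) \<Rightarrow> _) \<in> borel_measurable borel"
    by (rule borel_measurable_continuous_onI)
  then show ?thesis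
    using assms by (intro measurable_restrict_space3) auto
qed

abbreviation point_mass :: "nat \<Rightarrow> (f2 \<Rightarrow> nat) measure" where
  "point_mass c \<equiv> return (restrict_space borel monotone_labellings) (\<lambda>_. c)"

lemma point_mass_invariant:
  assumes "c \<in> {0, 1}"
  shows "point_mass c \<in> invariant_measures monotone_labellings"
proof -
  let ?M = "restrict_space borel monotone_labellings"
  have space: "(\<lambda>_. c) \<in> space ?M"
    using const_monotone[OF assms] by (simp add: space_restrict_space)
  have meas: "shift_action g \<in> measurable ?M ?M" for g
    by (rule shift_action_measurable) (rule shift_monotone)
  have "distr (point_mass c) (point_mass c) (shift_action g) = point_mass c" for g
  proof -
    have "distr (point_mass c) (point_mass c) (shift_action g) = distr (point_mass c) ?M (shift_action g)"
      by (rule distr_cong) simp_all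
    also have "\<dots> = return ?M (shift_action g (\<lambda>_. c))"
      by (rule distr_return[OF meas space])
    finally show ?thesis by (simp add: shift_action_def)
  qed
  then show ?thesis
    using meas prob_space_return[OF space]
    by (simp add: invariant_measures_def pmp_action_def shift_action_add shift_action_zero
        cong: measurable_cong_sets)
qed

lemma point_mass_f_invariant: "shift_f_invariant monotone_labellings (point_mass c) = 0"
  unfolding shift_f_invariant_def
proof (rule f_invariant_zero_one_law)
  fix A :: "(f2 \<Rightarrow> nat) set"
  show "measure (point_mass c) A \<in> {0, 1}"
    by (cases "A \<in> sets (restrict_space borel monotone_labellings)")
      (auto simp: measure_return measure_notin_sets indicator_def)
qed

lemma coordinate_level_measurable:
  fixes X :: "('g::countable \<Rightarrow> 'k::discrete_topology) set"
  shows "{x \<in> X. x g = k} \<in> sets (restrict_space borel X)"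
proof -
  have "(\<lambda>x. x g) -` {k} \<in> sets (borel :: ('g \<Rightarrow> 'k) measure)"
    by (intro borel_open open_vimage continuous_on_product_coordinates) (rule Topological_Spaces.open_discrete)
  then have "X \<inter> (\<lambda>x. x g) -` {k} \<in> sets (restrict_space borel X)"
    unfolding sets_restrict_space by (rule imageI)
  moreover have "{x \<in> X. x g = k} = X \<inter> (\<lambda>x. x g) -` {k}" by blast
  ultimately show ?thesis by simp
qed

lemma point_mass_distinct: "point_mass 0 \<noteq> point_mass 1"
proof
  assume eq: "point_mass 0 = point_mass 1"
  let ?A = "{x \<in> monotone_labellings. x 0 = 0}"
  have "measure (point_mass 0) ?A = 1" "measure (point_mass 1) ?A = 0"
    using const_monotone[of 0] by (simp_all add: measure_return coordinate_level_measurable)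
  then show False using eq by simp
qed


section \<open>No invariant measure has positive f-invariant\<close>

text \<open>
  With two generators, entropies \<open>H\<^sub>a, H\<^sub>b \<le> H\<close> of the joins give \<open>H\<^sub>a + H\<^sub>b - 3 * H \<le> - H\<close>.
\<close>

lemma F_value_nonpos:
  assumes "0 \<le> shannon_entropy M P"
    and "\<And>s. shannon_entropy M (partition_join P ((`) (T (gen_f2 s)) ` P)) \<le> shannon_entropy M P"
  shows "F_value M T P \<le> 0"
proof -
  have "Rep_f2 (gen_f2 GenA) \<noteq> Rep_f2 (gen_f2 GenB)" by (simp add: gen_f2.rep_eq)
  then have "gen_f2 GenA \<noteq> gen_f2 GenB" by metis
  then show ?thesis using assms(1) assms(2)[of GenA] assms(2)[of GenB] by (simp add: F_value_def)
qed

lemma shannon_entropy_nonneg: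
  assumes "prob_space M" shows "0 \<le> shannon_entropy M P"
proof -
  interpret prob_space M by fact
  have "measure M A * ln (measure M A) \<le> 0" for A
    by (cases "measure M A = 0")
      (auto intro!: mult_nonneg_nonpos simp: zero_less_measure_iff)
  then show ?thesis
    unfolding shannon_entropy_def infsum_uminus[symmetric] by (intro infsum_nonneg) simp
qed

text \<open>
  The infimum defining the f-invariant is estimated at \<open>W = {0}\<close>. There monotonicity and
  invariance together make the join of the coordinate partition with its translate by a
  generator equal, up to a null set, to the coordinate partition itself.
\<close>

lemma shift_f_invariant_nonpos:
  assumes \<nu>: "\<nu> \<in> invariant_measures monotone_labellings"
  shows "shift_f_invariant monotone_labellings \<nu> \<le> 0"
proof -
  let ?X = monotone_labellings and ?P = "coordinate_partition monotone_labellings"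
  define Q where "Q h i = {x \<in> ?X. x h = i}" for h i
  have sets: "sets \<nu> = sets (restrict_space borel ?X)"
    using \<nu> by (simp add: invariant_measures_def)
  have space: "space \<nu> = ?X"
    by (simp add: sets_eq_imp_space_eq[OF sets] space_restrict_space)
  have prob: "prob_space \<nu>" and pres: "distr \<nu> \<nu> (shift_action g) = \<nu>"
    and meas: "shift_action g \<in> measurable \<nu> \<nu>" for g
    using \<nu> by (auto simp: invariant_measures_def pmp_action_def)
  interpret prob_space \<nu> by fact
  have Q_sets: "Q h i \<in> sets \<nu>" for h i
    by (simp add: Q_def sets coordinate_level_measurable)
  have shift_preimage: "shift_action h -` Q h i \<inter> space \<nu> = Q 0 i" for h i
    using shift_monotone by (auto simp: Q_def space shift_action_def)
  have shift_image: "shift_action h ` Q 0 i = Q h i" for h i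
  proof (intro set_eqI iffI)
    fix x assume "x \<in> Q h i"
    then have "shift_action (- h) x \<in> Q 0 i" "shift_action h (shift_action (- h) x) = x"
      using shift_monotone[of x "- h"] by (auto simp: Q_def shift_action_def add.assoc[symmetric])
    then show "x \<in> shift_action h ` Q 0 i" by (metis imageI)
  qed (use shift_monotone[of _ h] in \<open>auto simp: Q_def shift_action_def\<close>)
  have stationary: "measure \<nu> (Q h i) = measure \<nu> (Q 0 i)" for h i
    using measure_distr[OF meas Q_sets, of h h i] by (simp add: pres shift_preimage)
  note vals = monotone_labellings_values
  have P: "?P = {Q 0 0, Q 0 1}"
  proof -
    have "(\<lambda>x. x 0) ` ?X \<subseteq> {0, 1}" using vals by (simp add: image_subset_iff)
    moreover have "i \<in> (\<lambda>x. x 0) ` ?X" if "i \<in> {0, 1}" for i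
      by (rule image_eqI[OF _ const_monotone[OF that]]) simp
    ultimately have "(\<lambda>x. x 0) ` ?X = {0, 1}" by blast
    then show ?thesis by (simp only: coordinate_partition_def Q_def Setcompr_eq_image image_insert image_empty)
  qed
  have nonempty: "(\<lambda>_. i) \<in> Q h i" if "i \<in> {0, 1}" for h i
    using const_monotone[OF that] by (simp add: Q_def)
  have disj: "(\<lambda>_. i) \<notin> Q h j" if "i \<noteq> j" for h i j using that by (simp add: Q_def)
  have refined: "refined_partition \<nu> shift_action ?P {0} = ?P"
  proof -
    have eq: "{x \<in> space \<nu>. \<forall>w\<in>{0}. shift_action w x \<in> \<phi> w} = \<phi> 0" if "\<phi> \<in> {0} \<rightarrow> ?P" for \<phi>
      using that by (auto simp: space P Q_def shift_action_def Pi_iff)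
    have "refined_partition \<nu> shift_action ?P {0} = {\<phi> 0 | \<phi>. \<phi> \<in> {0 :: f2} \<rightarrow> ?P} - {{}}"
      unfolding refined_partition_def using eq by (intro arg_cong2[where f = "(-)"] Collect_cong) auto
    also have "{\<phi> 0 | \<phi>. \<phi> \<in> {0 :: f2} \<rightarrow> ?P} = ?P"
      by (auto intro!: exI[of _ "\<lambda>_. A" for A])
    finally show ?thesis using nonempty by (auto simp: P)
  qed
  have "shannon_entropy \<nu> (partition_join ?P ((`) (shift_action (gen_f2 s)) ` ?P)) = shannon_entropy \<nu> ?P" for s
  proof -
    let ?s = "gen_f2 s" and ?\<eta> = "\<lambda>A. measure \<nu> A * ln (measure \<nu> A)"
    let ?N = "Q ?s 1 - Q 0 1"
    have step: "x 0 \<le> x ?s" if "x \<in> ?X" for x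
      using that unfolding monotone_labellings_def by (metis (mono_tags, lifting) add.left_neutral mem_Collect_eq)
    have up: "Q 0 1 \<subseteq> Q ?s 1"
    proof
      fix x assume "x \<in> Q 0 1"
      then show "x \<in> Q ?s 1" using step[of x] vals[of x ?s] by (auto simp: Q_def)
    qed
    \<comment> \<open>An increasing edge has probability zero: its two ends have the same distribution.\<close>
    have null: "measure \<nu> ?N = 0"
      using finite_measure_Diff[OF Q_sets Q_sets up] stationary[of ?s 1] by simp
    have cells: "Q 0 0 \<inter> Q ?s 0 = Q ?s 0" "Q 0 0 \<inter> Q ?s 1 = ?N" "Q 0 1 \<inter> Q ?s 0 = {}" "Q 0 1 \<inter> Q ?s 1 = Q 0 1"
    proof -
      have "x \<in> ?X \<Longrightarrow> x 0 = 0 \<and> x ?s = 0 \<or> x 0 = 0 \<and> x ?s = 1 \<or> x 0 = 1 \<and> x ?s = 1" for x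
        using step[of x] vals[of x 0] vals[of x ?s] by auto
      then show "Q 0 0 \<inter> Q ?s 0 = Q ?s 0" "Q 0 0 \<inter> Q ?s 1 = ?N" "Q 0 1 \<inter> Q ?s 0 = {}"
          "Q 0 1 \<inter> Q ?s 1 = Q 0 1"
        unfolding Q_def by force+
    qed
    have image: "(`) (shift_action ?s) ` ?P = {Q ?s 0, Q ?s 1}"
      by (simp add: P shift_image)
    have join: "partition_join ?P ((`) (shift_action ?s) ` ?P) = {Q ?s 0, ?N, {}, Q 0 1} - {{}}"
    proof -
      have "{A \<inter> B | A B. A \<in> {Q 0 0, Q 0 1} \<and> B \<in> {Q ?s 0, Q ?s 1}} =
          {Q 0 0 \<inter> Q ?s 0, Q 0 0 \<inter> Q ?s 1, Q 0 1 \<inter> Q ?s 0, Q 0 1 \<inter> Q ?s 1}" by blast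
      then show ?thesis unfolding partition_join_def image unfolding P cells by simp
    qed
    have distinct: "Q h 0 \<noteq> Q 0 1" for h using nonempty[of 0 h] disj[of 0 1 0] by auto
    \<comment> \<open>Up to the null cell, the translated cell \<open>Q s 0\<close> plays the role of \<open>Q 0 0\<close>.\<close>
    have "infsum ?\<eta> ({Q ?s 0, ?N, {}, Q 0 1} - {{}}) = infsum ?\<eta> {Q ?s 0, Q 0 1}"
      using null nonempty[of 0 ?s] nonempty[of 1 0] by (intro infsum_cong_neutral) auto
    also have "\<dots> = infsum ?\<eta> {Q 0 0, Q 0 1}"
      using distinct[of ?s] distinct[of 0] stationary[of ?s 0] by simp
    finally show ?thesis unfolding shannon_entropy_def join by (simp only: P)
  qed
  then have "F_value \<nu> shift_action ?P \<le> 0"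
    by (intro F_value_nonpos shannon_entropy_nonneg prob) simp
  then have "ereal (F_value \<nu> shift_action (refined_partition \<nu> shift_action ?P {0})) \<le> 0"
    by (simp add: refined)
  then show ?thesis
    unfolding shift_f_invariant_def f_invariant_def by (intro INF_lower2[of "{0}"]) auto
qed

lemma point_mass_maximal: "c \<in> {0, 1} \<Longrightarrow> point_mass c \<in> max_f_measures monotone_labellings"
  unfolding max_f_measures_def point_mass_f_invariant mem_Collect_eq
  using point_mass_invariant shift_f_invariant_nonpos by blast

theorem theorem8p2:
  shows "\<exists>(K :: nat set) (X :: (f2 \<Rightarrow> nat) set).
           subshift_of_finite_type K X \<and> topologically_transitive X \<and>
           (\<exists>\<mu>\<in>max_f_measures X. \<exists>\<mu>'\<in>max_f_measures X. \<mu> \<noteq> \<mu>')"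
proof (intro exI conjI)
  show "subshift_of_finite_type {0, 1} monotone_labellings"
    by (rule monotone_labellings_sft)
  show "topologically_transitive monotone_labellings"
    by (rule monotone_labellings_transitive)
  have "point_mass 0 \<in> max_f_measures monotone_labellings"
      "point_mass 1 \<in> max_f_measures monotone_labellings"
    by (rule point_mass_maximal, simp)+
  then show "\<exists>\<mu>\<in>max_f_measures monotone_labellings. \<exists>\<mu>'\<in>max_f_measures monotone_labellings. \<mu> \<noteq> \<mu>'"
    by (intro bexI[of _ "point_mass 0"] bexI[of _ "point_mass 1"] point_mass_distinct)
qed

end
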